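(* Let $(\mathbf{W},\mathbf{w})$ be a fusion frame for $\mathcal{H}$. Let $(\mathbf{V},\mathbf{v})=\{(V_i,v_i)\}_{i=1}^m$ be a family of subspaces of $\mathcal{H}$ with weights, and $Q\in L(\mathcal{W},\mathcal{V})$. Then $(\mathbf{V},\mathbf{v})$ is a $Q$-component preserving dual fusion frame of $(\mathbf{W},\mathbf{w})$ if and only if there is some $A\in\mathfrak{L}_{T^{*}_{\mathbf{W},\mathbf{w}}}$ such that $V_i=AM_i\mathcal{W}$ for each $i\in\{1,\ldots,m\}$ and $Q=Q_{A,\mathbf{v}}$. Moreover, any element of $\mathfrak{L}_{T^{*}_{\mathbf{W},\mathbf{w}}}$ is of the form $T_{\mathbf{V},\mathbf{v}}Q$ where $(\mathbf{V},\mathbf{v})$ is some $Q$-component preserving dual fusion frame of $(\mathbf{W},\mathbf{w})$.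
   Context: $\mathcal{H}$ is a finite-dimensional Hilbert space over $\mathbb{F}=\mathbb{R}$ or $\mathbb{C}$, $m\in\mathbb{N}$, and $L(\mathcal{X},\mathcal{Y})$ is the space of linear maps $\mathcal{X}\to\mathcal{Y}$. A Bessel fusion sequence $(\mathbf{W},\mathbf{w})=\{(W_i,w_i)\}_{i=1}^m$ is a family of subspaces $W_i$ of $\mathcal{H}$ with weights $w_i>0$. Put $\mathcal{W}=\bigoplus_{i=1}^m W_i=\{(f_i)_{i=1}^m: f_i\in W_i\}$ (external direct sum) with inner product $\langle (f_i),(g_i)\rangle=\sum_i\langle f_i,g_i\rangle$; similarly $\mathcal{V}=\bigoplus_{i=1}^m V_i$ for $(\mathbf{V},\mathbf{v})$. The synthesis operator is $T_{\mathbf{W},\mathbf{w}}:\mathcal{W}\to\mathcal{H}$, $T_{\mathbf{W},\mathbf{w}}(f_i)_{i}=\sum_i w_if_i$, and its adjoint, the analysis operator, is $T^*_{\mathbf{W},\mathbf{w}}f=(w_i\pi_{W_i}f)_{i}$, where $\pi_{W_i}$ is the orthogonal projection onto $W_i$. $(\mathbf{W},\mathbf{w})$ is a fusion frame for $\mathcal{H}$ if $\mathrm{span}\bigcup_i W_i=\mathcal{H}$. For an injective linear map $T$, $\mathfrak{L}_T$ is the set of its (linear) left inverses. $M_j=M_{j,\mathbf{W}}:\mathcal{W}\to\mathcal{W}$ is the operator that keeps the $j$-th component and replaces all others by $0$; $M_{j,\mathbf{V}}$ is the analogous operator on $\mathcal{V}$. A map $Q\in L(\mathcal{W},\mathcal{V})$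 is component preserving if $QM_{j,\mathbf{W}}\mathcal{W}=M_{j,\mathbf{V}}\mathcal{V}$ for each $j$. If $(\mathbf{W},\mathbf{w})$, $(\mathbf{V},\mathbf{v})$ are fusion frames for $\mathcal{H}$ and $Q\in L(\mathcal{W},\mathcal{V})$, then $(\mathbf{V},\mathbf{v})$ is a $Q$-dual fusion frame of $(\mathbf{W},\mathbf{w})$ if $T_{\mathbf{V},\mathbf{v}}QT^*_{\mathbf{W},\mathbf{w}}=I_{\mathcal{H}}$; it is a $Q$-component preserving dual fusion frame if moreover $Q$ is component preserving. For $A\in L(\mathcal{W},\mathcal{H})$, weights $\mathbf{v}$, and $V_i=AM_i\mathcal{W}$, the map $Q_{A,\mathbf{v}}:\mathcal{W}\to\mathcal{V}$ is $Q_{A,\mathbf{v}}(f_j)_{j=1}^m=\left(\frac{1}{v_i}AM_i(f_j)_{j=1}^m\right)_{i=1}^m$. *)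

theory Defs
  imports Complex_Main "HOL-Library.FuncSet" "HOL-Library.Function_Algebras"
begin

text \<open>
  The scalar field is \<open>\<real>\<close> or \<open>\<complex>\<close>: up to isomorphism the following class has
  exactly these two members, both registered below.
\<close>

class real_or_complex = real_field +
  fixes to_complex :: "'a \<Rightarrow> complex"
  assumes to_complex_add: "to_complex (a + b) = to_complex a + to_complex b"
    and to_complex_mult: "to_complex (a * b) = to_complex a * to_complex b"
    and to_complex_scaleR: "to_complex (r *\<^sub>R a) = of_real r * to_complex a"
    and inj_to_complex: "inj to_complex"
    and range_to_complex: "range to_complex = \<real> \<or> range to_complex = UNIV"

instantiation real :: real_or_complex
begin
definition to_complex_real :: "real \<Rightarrow> complex" where
  "to_complex_real = complex_of_real"
instance
  by standard (auto simp: to_complex_real_def inj_on_def Reals_def)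
end

instantiation complex :: real_or_complex
begin
definition to_complex_complex :: "complex \<Rightarrow> complex" where
  "to_complex_complex = (\<lambda>z. z)"
instance
  by standard (auto simp: to_complex_complex_def scaleR_conv_of_real)
end

text \<open>
  The inner product is linear in the first argument; completeness is automatic in
  finite dimension.
\<close>

locale finite_dim_hilbert = vector_space scale
  for scale :: "'k::real_or_complex \<Rightarrow> 'h::ab_group_add \<Rightarrow> 'h" +
  fixes ip :: "'h \<Rightarrow> 'h \<Rightarrow> 'k"
  assumes ip_add_left: "ip (x + y) z = ip x z + ip y z"
    and ip_scale_left: "ip (scale c x) y = c * ip x y"
    and ip_sym: "to_complex (ip y x) = cnj (to_complex (ip x y))"
    and ip_pos: "x \<noteq> 0 \<Longrightarrow> Re (to_complex (ip x x)) > 0"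
    and finite_dim: "\<exists>B. finite B \<and> span B = UNIV"

text \<open>
  Linear maps between (carriers of) vector spaces are extensional functions, i.e.
  \<open>undefined\<close> off the domain, so that \<open>=\<close> between them is equality of maps.
\<close>

definition lin_maps ::
  "('k \<Rightarrow> 'x \<Rightarrow> 'x) \<Rightarrow> 'x set \<Rightarrow> ('k \<Rightarrow> 'y \<Rightarrow> 'y) \<Rightarrow> 'y set \<Rightarrow> ('x::plus \<Rightarrow> 'y::plus) set" where
  "lin_maps sX X sY Y =
     {T \<in> X \<rightarrow>\<^sub>E Y. (\<forall>x\<in>X. \<forall>y\<in>X. T (x + y) = T x + T y) \<and> (\<forall>c. \<forall>x\<in>X. T (sX c x) = sY c (T x))}"

definition left_inverses ::
  "('k \<Rightarrow> 'x \<Rightarrow> 'x) \<Rightarrow> 'x set \<Rightarrow> ('k \<Rightarrow> 'y \<Rightarrow> 'y) \<Rightarrow> 'y set \<Rightarrow> ('x::plus \<Rightarrow> 'y::plus) \<Rightarrow> ('y \<Rightarrow> 'x) set" where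
  "left_inverses sX X sY Y T = {A \<in> lin_maps sY Y sX X. \<forall>x\<in>X. A (T x) = x}"

definition adjoint_map ::
  "('k \<Rightarrow> 'x \<Rightarrow> 'x) \<Rightarrow> ('x \<Rightarrow> 'x \<Rightarrow> 'k) \<Rightarrow> 'x set \<Rightarrow> ('k \<Rightarrow> 'y \<Rightarrow> 'y) \<Rightarrow> ('y \<Rightarrow> 'y \<Rightarrow> 'k) \<Rightarrow> 'y set
    \<Rightarrow> ('x::plus \<Rightarrow> 'y::plus) \<Rightarrow> 'y \<Rightarrow> 'x" where
  "adjoint_map sX ipX X sY ipY Y T =
     (THE S. S \<in> lin_maps sY Y sX X \<and> (\<forall>x\<in>X. \<forall>y\<in>Y. ipY (T x) y = ipX x (S y)))"

definition orth_proj :: "('h \<Rightarrow> 'h \<Rightarrow> 'k::zero) \<Rightarrow> 'h set \<Rightarrow> 'h::minus \<Rightarrow> 'h" where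
  "orth_proj ip U x = (THE p. p \<in> U \<and> (\<forall>u\<in>U. ip (x - p) u = 0))"

text \<open>
  Families of length \<open>m\<close> are indexed by \<open>{1..m}\<close>. An element of the external direct sum
  is a function on \<open>nat\<close> which is \<open>0\<close> outside \<open>{1..m}\<close>, so addition is the pointwise one
  of \<^theory>\<open>HOL-Library.Function_Algebras\<close>; the values of \<open>W\<close> and \<open>w\<close> outside
  \<open>{1..m}\<close> are irrelevant.
\<close>

definition dsum :: "nat \<Rightarrow> (nat \<Rightarrow> 'h::zero set) \<Rightarrow> (nat \<Rightarrow> 'h) set" where
  "dsum m W = {f. (\<forall>i\<in>{1..m}. f i \<in> W i) \<and> (\<forall>i. i \<notin> {1..m} \<longrightarrow> f i = 0)}"

definition dsum_scale :: "('k \<Rightarrow> 'h \<Rightarrow> 'h) \<Rightarrow> 'k \<Rightarrow> (nat \<Rightarrow> 'h) \<Rightarrow> nat \<Rightarrow> 'h" where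
  "dsum_scale scale c f = (\<lambda>i. scale c (f i))"

definition dsum_ip :: "('h \<Rightarrow> 'h \<Rightarrow> 'k::comm_monoid_add) \<Rightarrow> nat \<Rightarrow> (nat \<Rightarrow> 'h) \<Rightarrow> (nat \<Rightarrow> 'h) \<Rightarrow> 'k" where
  "dsum_ip ip m f g = (\<Sum>i\<in>{1..m}. ip (f i) (g i))"

definition bessel_fusion_sequence ::
  "('k::real_or_complex \<Rightarrow> 'h::ab_group_add \<Rightarrow> 'h) \<Rightarrow> nat \<Rightarrow> (nat \<Rightarrow> 'h set) \<Rightarrow> (nat \<Rightarrow> real) \<Rightarrow> bool" where
  "bessel_fusion_sequence scale m W w \<longleftrightarrow> (\<forall>i\<in>{1..m}. module.subspace scale (W i) \<and> w i > 0)"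

definition fusion_frame ::
  "('k::real_or_complex \<Rightarrow> 'h::ab_group_add \<Rightarrow> 'h) \<Rightarrow> nat \<Rightarrow> (nat \<Rightarrow> 'h set) \<Rightarrow> (nat \<Rightarrow> real) \<Rightarrow> bool" where
  "fusion_frame scale m W w \<longleftrightarrow>
     bessel_fusion_sequence scale m W w \<and> module.span scale (\<Union>i\<in>{1..m}. W i) = UNIV"

definition synthesis ::
  "('k::real_or_complex \<Rightarrow> 'h::ab_group_add \<Rightarrow> 'h) \<Rightarrow> nat \<Rightarrow> (nat \<Rightarrow> 'h set) \<Rightarrow> (nat \<Rightarrow> real)
    \<Rightarrow> (nat \<Rightarrow> 'h) \<Rightarrow> 'h" where
  "synthesis scale m W w = (\<lambda>f\<in>dsum m W. \<Sum>i\<in>{1..m}. scale (of_real (w i)) (f i))"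

definition analysis ::
  "('k::real_or_complex \<Rightarrow> 'h::ab_group_add \<Rightarrow> 'h) \<Rightarrow> ('h \<Rightarrow> 'h \<Rightarrow> 'k) \<Rightarrow> nat
    \<Rightarrow> (nat \<Rightarrow> 'h set) \<Rightarrow> (nat \<Rightarrow> real) \<Rightarrow> 'h \<Rightarrow> nat \<Rightarrow> 'h" where
  "analysis scale ip m W w =
     adjoint_map (dsum_scale scale) (dsum_ip ip m) (dsum m W) scale ip UNIV (synthesis scale m W w)"

text \<open>\<open>M\<^sub>j\<close>: keeps the \<open>j\<close>-th component and replaces all others by \<open>0\<close>.\<close>

definition comp_op :: "nat \<Rightarrow> (nat \<Rightarrow> 'h::zero set) \<Rightarrow> nat \<Rightarrow> (nat \<Rightarrow> 'h) \<Rightarrow> nat \<Rightarrow> 'h" where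
  "comp_op m W j = (\<lambda>f\<in>dsum m W. \<lambda>i. if i = j then f i else 0)"

definition component_preserving ::
  "nat \<Rightarrow> (nat \<Rightarrow> 'h::zero set) \<Rightarrow> (nat \<Rightarrow> 'h set) \<Rightarrow> ((nat \<Rightarrow> 'h) \<Rightarrow> nat \<Rightarrow> 'h) \<Rightarrow> bool" where
  "component_preserving m W V Q \<longleftrightarrow>
     (\<forall>j\<in>{1..m}. Q ` (comp_op m W j ` dsum m W) = comp_op m V j ` dsum m V)"

text \<open>\<open>(V, v)\<close> is a \<open>Q\<close>-dual of \<open>(W, w)\<close>; the reference frame comes first.\<close>

definition dual_fusion_frame ::
  "('k::real_or_complex \<Rightarrow> 'h::ab_group_add \<Rightarrow> 'h) \<Rightarrow> ('h \<Rightarrow> 'h \<Rightarrow> 'k) \<Rightarrow> nat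
    \<Rightarrow> (nat \<Rightarrow> 'h set) \<Rightarrow> (nat \<Rightarrow> real) \<Rightarrow> (nat \<Rightarrow> 'h set) \<Rightarrow> (nat \<Rightarrow> real)
    \<Rightarrow> ((nat \<Rightarrow> 'h) \<Rightarrow> nat \<Rightarrow> 'h) \<Rightarrow> bool" where
  "dual_fusion_frame scale ip m W w V v Q \<longleftrightarrow>
     fusion_frame scale m W w \<and> fusion_frame scale m V v \<and>
     Q \<in> lin_maps (dsum_scale scale) (dsum m W) (dsum_scale scale) (dsum m V) \<and>
     synthesis scale m V v \<circ> Q \<circ> analysis scale ip m W w = id"

definition component_preserving_dual ::
  "('k::real_or_complex \<Rightarrow> 'h::ab_group_add \<Rightarrow> 'h) \<Rightarrow> ('h \<Rightarrow> 'h \<Rightarrow> 'k) \<Rightarrow> nat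
    \<Rightarrow> (nat \<Rightarrow> 'h set) \<Rightarrow> (nat \<Rightarrow> real) \<Rightarrow> (nat \<Rightarrow> 'h set) \<Rightarrow> (nat \<Rightarrow> real)
    \<Rightarrow> ((nat \<Rightarrow> 'h) \<Rightarrow> nat \<Rightarrow> 'h) \<Rightarrow> bool" where
  "component_preserving_dual scale ip m W w V v Q \<longleftrightarrow>
     dual_fusion_frame scale ip m W w V v Q \<and> component_preserving m W V Q"

definition Q_map ::
  "('k::real_or_complex \<Rightarrow> 'h::ab_group_add \<Rightarrow> 'h) \<Rightarrow> nat \<Rightarrow> (nat \<Rightarrow> 'h set)
    \<Rightarrow> ((nat \<Rightarrow> 'h) \<Rightarrow> 'h) \<Rightarrow> (nat \<Rightarrow> real) \<Rightarrow> (nat \<Rightarrow> 'h) \<Rightarrow> nat \<Rightarrow> 'h" where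
  "Q_map scale m W A v =
     (\<lambda>f\<in>dsum m W. \<lambda>i. if i \<in> {1..m} then scale (of_real (1 / v i)) (A (comp_op m W i f)) else 0)"

text \<open>
  The adjoint above exists and is unique, and the analysis operator is
  \<open>f \<mapsto> (w\<^sub>i \<pi>\<^bsub>W i\<^esub> f)\<^sub>i\<close>.
\<close>

context finite_dim_hilbert
begin

lemma to_complex_of_real: "to_complex (of_real r :: 'k) = of_real r"
proof -
  have "to_complex (0::'k) = 0" using to_complex_add[of 0 "0::'k"] by simp
  then have "to_complex (1::'k) \<noteq> 0" by (metis inj_to_complex injD zero_neq_one)
  then have "to_complex (1::'k) = 1" using to_complex_mult[of 1 "1::'k"] by simp
  then show ?thesis by (simp add: of_real_def to_complex_scaleR)
qed

lemma to_complex_0: "to_complex (0::'k) = 0"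
  using to_complex_of_real[of 0] by simp

lemma ip_sym_eq_0: "ip y x = 0 \<longleftrightarrow> ip x y = 0"
  by (metis ip_sym to_complex_0 inj_to_complex complex_cnj_zero injD)

lemma ip_add_right: "ip x (y + z) = ip x y + ip x z"
  by (rule injD[OF inj_to_complex])
    (metis ip_sym ip_add_left to_complex_add complex_cnj_add)

lemma ip_scale_of_real_right: "ip x (scale (of_real r) y) = of_real r * ip x y"
  by (rule injD[OF inj_to_complex])
    (metis ip_sym ip_scale_left to_complex_mult to_complex_of_real complex_cnj_mult
      complex_cnj_complex_of_real)

lemma ip_zero_left: "ip 0 x = 0"
  using ip_add_left[of 0 0 x] by simp

lemma ip_zero_right: "ip x 0 = 0"
  using ip_add_right[of x 0 0] by simp

lemma ip_diff_left: "ip (x - y) z = ip x z - ip y z"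
  using ip_add_left[of "x - y" y z] by simp

lemma ip_diff_right: "ip x (y - z) = ip x y - ip x z"
  using ip_add_right[of x "y - z" z] by simp

lemma ip_scale_right_0: "ip x y = 0 \<Longrightarrow> ip x (scale c y) = 0"
  by (metis ip_sym_eq_0 ip_scale_left mult_zero_right)

lemma ip_self_0: "ip x x = 0 \<Longrightarrow> x = 0"
  using ip_pos[of x] to_complex_0 by fastforce

lemma ip_sum_left: "ip (\<Sum>i\<in>I. g i) y = (\<Sum>i\<in>I. ip (g i) y)"
  by (induction I rule: infinite_finite_induct) (auto simp: ip_zero_left ip_add_left)

lemma proj_exists_span:
  assumes "finite B"
  shows "\<exists>p\<in>span B. \<forall>u\<in>span B. ip (x - p) u = 0"
  using assms
proof (induction B arbitrary: x rule: finite_induct)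
  case empty
  then show ?case by (auto simp: ip_zero_right)
next
  case (insert b B)
  obtain q where q: "q \<in> span B" "\<forall>u\<in>span B. ip (b - q) u = 0"
    using insert.IH by blast
  obtain p where p: "p \<in> span B" "\<forall>u\<in>span B. ip (x - p) u = 0"
    using insert.IH by blast
  define e where "e = b - q"
  define c where "c = ip x e / ip e e"
  have e_orth: "ip e u = 0" if "u \<in> span B" for u
    using q that by (simp add: e_def)
  have sub: "span B \<subseteq> span (insert b B)" by (rule span_mono) auto
  have "e \<in> span (insert b B)"
    unfolding e_def using q sub by (intro span_diff) (auto intro: span_base)
  then have pin: "p + scale c e \<in> span (insert b B)"
    using p sub by (intro span_add span_scale) auto
  have 1: "ip (x - (p + scale c e)) e = 0"
  proof (cases "e = 0")
    case True then show ?thesis by (simp add: ip_zero_right)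
  next
    case False
    then have "ip e e \<noteq> 0" using ip_self_0 by blast
    moreover have "ip p e = 0" using e_orth[OF p(1)] ip_sym_eq_0 by blast
    ultimately show ?thesis by (simp add: ip_diff_left ip_add_left ip_scale_left c_def)
  qed
  have 2: "ip (x - (p + scale c e)) u = 0" if "u \<in> span B" for u
    using p(2) e_orth[OF that] that by (simp add: ip_diff_left ip_add_left ip_scale_left)
  have "ip (x - (p + scale c e)) u = 0" if u: "u \<in> span (insert b B)" for u
  proof -
    obtain k where k: "u - scale k b \<in> span B" using u by (auto simp: span_insert)
    define s where "s = (u - scale k b) + scale k q"
    have s: "s \<in> span B" unfolding s_def using k q by (intro span_add span_scale) auto
    have "u = s + scale k e" by (simp add: s_def e_def scale_right_diff_distrib)
    then show ?thesis using 1 2[OF s] by (simp add: ip_add_right ip_scale_right_0)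
  qed
  with pin show ?case by blast
qed

lemma proj_exists:
  assumes U: "subspace U"
  shows "\<exists>!p. p \<in> U \<and> (\<forall>u\<in>U. ip (x - p) u = 0)"
proof -
  obtain B where B: "B \<subseteq> U" "independent B" "U \<subseteq> span B"
    using maximal_independent_subset[of U] by blast
  obtain F where F: "finite F" "span F = UNIV" using finite_dim by blast
  have "finite B" using independent_span_bound[OF F(1) B(2)] F(2) by auto
  moreover have "span B = U" using B U by (simp add: span_subspace)
  ultimately obtain p where p: "p \<in> U" "\<forall>u\<in>U. ip (x - p) u = 0"
    using proj_exists_span by metis
  have "q = p" if q: "q \<in> U" "\<forall>u\<in>U. ip (x - q) u = 0" for q
  proof -
    have "q - p \<in> U" using p q U by (simp add: subspace_diff)
    then have "ip (x - p) (q - p) = 0" "ip (x - q) (q - p) = 0" using p q by auto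
    then have "ip (q - p) (q - p) = 0" by (simp add: ip_diff_left)
    then show ?thesis using ip_self_0 by fastforce
  qed
  with p show ?thesis by blast
qed

lemma orth_proj:
  assumes "subspace U"
  shows "orth_proj ip U x \<in> U" "u \<in> U \<Longrightarrow> ip (x - orth_proj ip U x) u = 0"
  using theI'[OF proj_exists[OF assms, of x]] by (auto simp: orth_proj_def)

lemma orth_proj_eq:
  assumes "subspace U" "p \<in> U" "\<And>u. u \<in> U \<Longrightarrow> ip (x - p) u = 0"
  shows "orth_proj ip U x = p"
  unfolding orth_proj_def
  by (rule the1_equality[OF proj_exists[OF assms(1)]]) (use assms in auto)

lemma orth_proj_add:
  assumes "subspace U"
  shows "orth_proj ip U (x + y) = orth_proj ip U x + orth_proj ip U y"
  using orth_proj(2)[OF assms, of _ x] orth_proj(2)[OF assms, of _ y] orth_proj(1)[OF assms]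
  by (intro orth_proj_eq[OF assms])
    (auto simp: subspace_add[OF assms] ip_add_left ip_diff_left)

lemma orth_proj_scale:
  assumes "subspace U"
  shows "orth_proj ip U (scale c x) = scale c (orth_proj ip U x)"
  using orth_proj(2)[OF assms, of _ x] orth_proj(1)[OF assms]
  by (intro orth_proj_eq[OF assms])
    (auto simp: subspace_scale[OF assms] ip_scale_left ip_diff_left)

theorem
  assumes W: "bessel_fusion_sequence scale m W w"
  shows synthesis_adjoint: "\<exists>!S. S \<in> lin_maps scale UNIV (dsum_scale scale) (dsum m W) \<and>
      (\<forall>f\<in>dsum m W. \<forall>y\<in>UNIV. ip (synthesis scale m W w f) y = dsum_ip ip m f (S y))" (is "\<exists>!S. ?P S")
    and analysis_eq: "analysis scale ip m W w =
      (\<lambda>x i. if i \<in> {1..m} then scale (of_real (w i)) (orth_proj ip (W i) x) else 0)" (is "_ = ?S")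
proof -
  have sub: "subspace (W i)" if "i \<in> {1..m}" for i
    using W that by (auto simp: bessel_fusion_sequence_def)
  have lin: "?S \<in> lin_maps scale UNIV (dsum_scale scale) (dsum m W)"
    by (auto simp: lin_maps_def dsum_def dsum_scale_def fun_eq_iff sub orth_proj orth_proj_add
        orth_proj_scale subspace_scale scale_right_distrib scale_left_commute)
  have adj: "ip (synthesis scale m W w f) y = dsum_ip ip m f (?S y)" if f: "f \<in> dsum m W" for f y
  proof -
    have "ip (scale (of_real (w i)) (f i)) y = ip (f i) (?S y i)" if i: "i \<in> {1..m}" for i
    proof -
      have "f i \<in> W i" using f i by (auto simp: dsum_def)
      then have "ip (y - orth_proj ip (W i) y) (f i) = 0" using orth_proj[OF sub[OF i]] by blast
      then have "ip (f i) (y - orth_proj ip (W i) y) = 0" using ip_sym_eq_0 by blast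
      then show ?thesis using i by (simp add: ip_diff_right ip_scale_left ip_scale_of_real_right)
    qed
    then show ?thesis using f by (simp add: synthesis_def dsum_ip_def ip_sum_left)
  qed
  have uniq: "S = ?S" if S: "?P S" for S
  proof (intro ext)
    fix y i
    have Sy: "S y \<in> dsum m W" "?S y \<in> dsum m W" using S lin by (auto simp: lin_maps_def)
    show "S y i = ?S y i"
    proof (cases "i \<in> {1..m}")
      case True
      define d where "d = S y i - ?S y i"
      have "d \<in> W i" unfolding d_def using Sy True sub[OF True]
        by (intro subspace_diff) (auto simp: dsum_def)
      define g where "g = (\<lambda>j. if j = i then d else 0)"
      have g: "g \<in> dsum m W"
        using \<open>d \<in> W i\<close> True sub by (auto simp: g_def dsum_def subspace_0)
      have gip: "dsum_ip ip m g h = ip d (h i)" for h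
      proof -
        have "dsum_ip ip m g h = (\<Sum>j\<in>{1..m}. if j = i then ip d (h j) else 0)"
          unfolding dsum_ip_def by (rule sum.cong) (auto simp: g_def ip_zero_left)
        then show ?thesis using True by simp
      qed
      have "dsum_ip ip m g (S y) = ip (synthesis scale m W w g) y" using S g by simp
      also have "\<dots> = dsum_ip ip m g (?S y)" by (rule adj[OF g])
      finally have "dsum_ip ip m g (S y) = dsum_ip ip m g (?S y)" .
      then have "ip d (S y i) = ip d (?S y i)" by (simp only: gip)
      then have "ip d d = 0" unfolding d_def by (simp add: ip_diff_right)
      then show ?thesis using ip_self_0 d_def by fastforce
    next
      case False then show ?thesis using Sy by (auto simp: dsum_def)
    qed
  qed
  show ex: "\<exists>!S. ?P S"
    by (rule ex1I[of _ ?S]) (use lin adj uniq in blast)+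
  show "analysis scale ip m W w = ?S"
    unfolding analysis_def adjoint_map_def
    by (rule the1_equality[OF ex]) (use lin adj in blast)
qed

end

end

theory Submission imports Defs begin

text \<open>
  Every element of the direct sum is the sum of its components, so a linear map out of it is
  determined by its restrictions to the summands: \<open>A = (\<Sum>i. A M\<^sub>i)\<close>. The map \<open>Q\<^bsub>A,v\<^esub>\<close> stores the
  terms of this sum, divided by the weights, in separate coordinates, and synthesis with \<open>v\<close> adds
  them up again, so \<open>A = T\<^bsub>V,v\<^esub> Q\<^bsub>A,v\<^esub>\<close>. Conversely, if \<open>Q\<close> is component preserving and
  \<open>A = T\<^bsub>V,v\<^esub> Q\<close>, then \<open>A M\<^sub>i f\<close> is \<open>v\<^sub>i\<close> times the \<open>i\<close>-th coordinate of \<open>Q f\<close>.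
\<close>

section \<open>Finite sums, linear maps on carriers, and decomposition into components\<close>

lemma sum_fun_apply: "(\<Sum>i\<in>I. g i) x = (\<Sum>i\<in>I. g i x)"
  for g :: "'i \<Rightarrow> 'a \<Rightarrow> 'b::comm_monoid_add"
  by (induction I rule: infinite_finite_induct) auto

lemma lin_maps_zero:
  fixes T :: "'x::monoid_add \<Rightarrow> 'y::group_add"
  assumes "T \<in> lin_maps sX X sY Y" "0 \<in> X"
  shows "T 0 = 0"
proof -
  have "T (0 + 0) = T 0 + T 0" using assms unfolding lin_maps_def by blast
  then show ?thesis by (metis add_0 add_right_cancel)
qed

lemma lin_maps_sum:
  fixes T :: "'x::comm_monoid_add \<Rightarrow> 'y::ab_group_add"
  assumes T: "T \<in> lin_maps sX X sY Y"
    and X: "0 \<in> X" "\<And>x y. x \<in> X \<Longrightarrow> y \<in> X \<Longrightarrow> x + y \<in> X"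
    and g: "\<And>i. i \<in> I \<Longrightarrow> g i \<in> X"
  shows "T (\<Sum>i\<in>I. g i) = (\<Sum>i\<in>I. T (g i))"
proof -
  \<comment> \<open>Membership of the partial sums in \<open>X\<close> is carried through the
    induction because \<open>T\<close> is additive on \<open>X\<close> only.\<close>
  have "(\<Sum>i\<in>I. g i) \<in> X \<and> T (\<Sum>i\<in>I. g i) = (\<Sum>i\<in>I. T (g i))"
    using g
  proof (induction I rule: infinite_finite_induct)
    case (insert i I)
    then show ?case using T X(2) by (simp add: lin_maps_def)
  qed (use X(1) lin_maps_zero[OF T] in simp_all)
  then show ?thesis ..
qed

lemma sum_comp_op:
  fixes W :: "nat \<Rightarrow> 'h::comm_monoid_add set"
  assumes f: "f \<in> dsum m W"
  shows "(\<Sum>i\<in>{1..m}. comp_op m W i f) = f"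
proof
  fix k
  have "(\<Sum>i\<in>{1..m}. comp_op m W i f) k = (\<Sum>i\<in>{1..m}. if k = i then f k else 0)"
    using f by (simp add: sum_fun_apply comp_op_def)
  \<comment> \<open>For \<open>k\<close> outside \<open>{1..m}\<close> no summand survives; there
    the convention that elements of \<open>dsum\<close> vanish off \<open>{1..m}\<close> gives
    \<open>f k = 0\<close> as well.\<close>
  also have "\<dots> = f k" using f by (auto simp: dsum_def)
  finally show "(\<Sum>i\<in>{1..m}. comp_op m W i f) k = f k" .
qed

context finite_dim_hilbert
begin

text \<open>This absorbs the weights: passing between \<open>A M\<^sub>i f\<close> and the
  \<open>i\<close>-th coordinate of \<open>Q f\<close> costs a factor \<open>v i\<close> or
  \<open>1 / v i\<close>, which does not change the set of values.\<close>

lemma scale_image_subspace: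
  assumes U: "subspace U" and c: "c \<noteq> 0"
  shows "scale c ` U = U"
proof (intro equalityI subsetI)
  fix x assume "x \<in> U"
  then have "scale (inverse c) x \<in> U" "x = scale c (scale (inverse c) x)"
    using U c by (simp_all add: subspace_scale)
  then show "x \<in> scale c ` U" by blast
qed (use U subspace_scale in blast)

section \<open>Direct sum and component operators of a single Bessel fusion sequence\<close>

context
  fixes m :: nat and W :: "nat \<Rightarrow> 'h set" and w :: "nat \<Rightarrow> real"
  assumes W: "bessel_fusion_sequence scale m W w"
begin

lemma bessel_subspace: "i \<in> {1..m} \<Longrightarrow> subspace (W i)"
  using W by (auto simp: bessel_fusion_sequence_def)

lemma bessel_weight_nonzero: "i \<in> {1..m} \<Longrightarrow> (of_real (w i) :: 'k) \<noteq> 0"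
  using W by (force simp: bessel_fusion_sequence_def)

lemma dsum_zero: "0 \<in> dsum m W"
  by (auto simp: dsum_def subspace_0 bessel_subspace)

lemma dsum_add: "f \<in> dsum m W \<Longrightarrow> g \<in> dsum m W \<Longrightarrow> f + g \<in> dsum m W"
  by (auto simp: dsum_def subspace_add bessel_subspace)

lemma dsum_dsum_scale: "f \<in> dsum m W \<Longrightarrow> dsum_scale scale c f \<in> dsum m W"
  by (auto simp: dsum_def dsum_scale_def subspace_scale bessel_subspace)

lemma comp_op_in_dsum: "f \<in> dsum m W \<Longrightarrow> comp_op m W j f \<in> dsum m W"
  by (auto simp: dsum_def comp_op_def subspace_0 bessel_subspace)

lemma comp_op_add:
  "f \<in> dsum m W \<Longrightarrow> g \<in> dsum m W \<Longrightarrow> comp_op m W j (f + g) = comp_op m W j f + comp_op m W j g"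
  using dsum_add by (auto simp: comp_op_def fun_eq_iff)

lemma comp_op_dsum_scale:
  "f \<in> dsum m W \<Longrightarrow> comp_op m W j (dsum_scale scale c f) = dsum_scale scale c (comp_op m W j f)"
  using dsum_dsum_scale by (auto simp: comp_op_def dsum_scale_def fun_eq_iff)

lemma comp_op_comp_op:
  "f \<in> dsum m W \<Longrightarrow> comp_op m W i (comp_op m W j f) = (if i = j then comp_op m W j f else 0)"
  using comp_op_in_dsum[of f j] by (auto simp: comp_op_def fun_eq_iff)

lemma single_in_dsum: "j \<in> {1..m} \<Longrightarrow> x \<in> W j \<Longrightarrow> (\<lambda>i. if i = j then x else 0) \<in> dsum m W"
  by (auto simp: dsum_def subspace_0 bessel_subspace)

text \<open>Identifying the range of \<open>M\<^sub>j\<close> with an embedded copy of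
  \<open>W j\<close> turns component preservation into an equation about subspaces of the Hilbert
  space.\<close>

lemma comp_op_image:
  assumes j: "j \<in> {1..m}"
  shows "comp_op m W j ` dsum m W = (\<lambda>x i. if i = j then x else 0) ` W j"
proof (intro equalityI subsetI)
  fix g assume "g \<in> comp_op m W j ` dsum m W"
  then show "g \<in> (\<lambda>x i. if i = j then x else 0) ` W j"
    using j by (force simp: comp_op_def dsum_def fun_eq_iff)
next
  fix g assume "g \<in> (\<lambda>x i. if i = j then x else 0) ` W j"
  then obtain x where x: "x \<in> W j" "g = (\<lambda>i. if i = j then x else 0)" by blast
  have "g \<in> dsum m W"
    using single_in_dsum[OF j x(1)] by (simp add: x(2))
  moreover from this have "comp_op m W j g = g" by (auto simp: comp_op_def x)
  ultimately show "g \<in> comp_op m W j ` dsum m W" by force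
qed

lemma analysis_in_dsum: "analysis scale ip m W w x \<in> dsum m W"
  using orth_proj(1)[OF bessel_subspace] bessel_subspace
  by (auto simp: analysis_eq[OF W] dsum_def subspace_scale)

text \<open>The codomain is left general because this is applied both to \<open>A\<close>, with
  values in the Hilbert space, and to \<open>Q\<close>, with values in a direct sum.\<close>

lemma lin_maps_dsum_eq_sum:
  fixes T :: "(nat \<Rightarrow> 'h) \<Rightarrow> 'y::ab_group_add"
  assumes "T \<in> lin_maps (dsum_scale scale) (dsum m W) sY Y" "f \<in> dsum m W"
  shows "T f = (\<Sum>i\<in>{1..m}. T (comp_op m W i f))"
  using lin_maps_sum[OF assms(1) dsum_zero dsum_add comp_op_in_dsum[OF assms(2)], of "\<lambda>i. i" "{1..m}"]
  by (simp only: sum_comp_op[OF assms(2)])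

lemma synthesis_lin_maps: "synthesis scale m W w \<in> lin_maps (dsum_scale scale) (dsum m W) scale UNIV"
  using dsum_add dsum_dsum_scale
  by (auto simp: synthesis_def lin_maps_def scale_right_distrib sum.distrib dsum_scale_def
      scale_sum_right mult.commute)

text \<open>Needed when only \<open>A\<close> is given and the sets \<open>A M\<^sub>j W\<close> are
  to be taken as the subspaces of a new fusion sequence.\<close>

lemma subspace_image_comp_op:
  assumes A: "A \<in> lin_maps (dsum_scale scale) (dsum m W) scale UNIV"
  shows "subspace (A ` (comp_op m W j ` dsum m W))"
proof -
  have "A 0 = 0" "comp_op m W j 0 = 0"
    using lin_maps_zero[OF A dsum_zero] dsum_zero by (auto simp: comp_op_def)
  then have "0 \<in> A ` (comp_op m W j ` dsum m W)"
    using dsum_zero by (metis image_eqI)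
  moreover have "A (comp_op m W j f) + A (comp_op m W j g) = A (comp_op m W j (f + g))"
    if "f \<in> dsum m W" "g \<in> dsum m W" for f g
    using that A by (simp add: lin_maps_def comp_op_add comp_op_in_dsum)
  moreover have "scale c (A (comp_op m W j f)) = A (comp_op m W j (dsum_scale scale c f))"
    if "f \<in> dsum m W" for c f
    using that A by (simp add: lin_maps_def comp_op_dsum_scale comp_op_in_dsum)
  ultimately show ?thesis
    using dsum_add dsum_dsum_scale by (auto simp: subspace_def)
qed

section \<open>The map \<open>Q_map\<close> built from \<open>A\<close>, and the dual it
  yields\<close>

lemma Q_map_lin_maps:
  assumes A: "A \<in> lin_maps (dsum_scale scale) (dsum m W) scale UNIV"
    and V: "bessel_fusion_sequence scale m V v"
    and AV: "\<And>i. i \<in> {1..m} \<Longrightarrow> V i = A ` (comp_op m W i ` dsum m W)"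
  shows "Q_map scale m W A v \<in> lin_maps (dsum_scale scale) (dsum m W) (dsum_scale scale) (dsum m V)"
proof -
  \<comment> \<open>The choice \<open>V i = A M\<^sub>i W\<close> is what puts the coordinates of
    \<open>Q_map\<close> into the right subspaces.\<close>
  have "scale c (A (comp_op m W i f)) \<in> V i" if "i \<in> {1..m}" "f \<in> dsum m W" for c i f
    using that AV V by (auto simp: bessel_fusion_sequence_def intro!: subspace_scale)
  then have "Q_map scale m W A v f \<in> dsum m V" if "f \<in> dsum m W" for f
    using that by (auto simp: Q_map_def dsum_def)
  moreover have "Q_map scale m W A v (f + g) = Q_map scale m W A v f + Q_map scale m W A v g"
    if "f \<in> dsum m W" "g \<in> dsum m W" for f g
    using that A dsum_add[OF that]
    by (auto simp: Q_map_def fun_eq_iff lin_maps_def comp_op_add comp_op_in_dsum scale_right_distrib)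
  moreover have "Q_map scale m W A v (dsum_scale scale c f) = dsum_scale scale c (Q_map scale m W A v f)"
    if "f \<in> dsum m W" for c f
  proof
    fix i
    have "A (comp_op m W i (dsum_scale scale c f)) = scale c (A (comp_op m W i f))"
      using A comp_op_dsum_scale[OF that] comp_op_in_dsum[OF that] by (simp add: lin_maps_def)
    then show "Q_map scale m W A v (dsum_scale scale c f) i = dsum_scale scale c (Q_map scale m W A v f) i"
      using that dsum_dsum_scale[OF that, of c]
      by (simp add: Q_map_def dsum_scale_def[of _ _ "_ :: nat \<Rightarrow> _"] scale_left_commute)
  qed
  ultimately show ?thesis
    by (auto simp: lin_maps_def Q_map_def)
qed

lemma synthesis_Q_map:
  assumes A: "A \<in> lin_maps (dsum_scale scale) (dsum m W) scale UNIV"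
    and V: "bessel_fusion_sequence scale m V v"
    and AV: "\<And>i. i \<in> {1..m} \<Longrightarrow> V i = A ` (comp_op m W i ` dsum m W)"
    and f: "f \<in> dsum m W"
  shows "synthesis scale m V v (Q_map scale m W A v f) = A f"
proof -
  have "Q_map scale m W A v f \<in> dsum m V"
    using Q_map_lin_maps[OF A V AV] f by (auto simp: lin_maps_def)
  then have "synthesis scale m V v (Q_map scale m W A v f)
      = (\<Sum>i\<in>{1..m}. scale (of_real (v i)) (scale (of_real (1 / v i)) (A (comp_op m W i f))))"
    using f by (simp add: synthesis_def Q_map_def)
  also have "\<dots> = (\<Sum>i\<in>{1..m}. A (comp_op m W i f))"
    using V by (intro sum.cong) (force simp: bessel_fusion_sequence_def simp flip: of_real_mult)+
  also have "\<dots> = A f" using lin_maps_dsum_eq_sum[OF A f] by simp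
  finally show ?thesis .
qed

end

text \<open>Since \<open>M\<^sub>i M\<^sub>j = 0\<close> for \<open>i \<noteq> j\<close>, the image
  of \<open>M\<^sub>j f\<close> is concentrated at \<open>j\<close>, with value
  \<open>A M\<^sub>j f\<close> divided by \<open>v j\<close>. As \<open>f\<close> varies, these
  values fill \<open>V j\<close> rescaled, which is \<open>V j\<close> itself.\<close>

lemma component_preserving_Q_map:
  assumes W: "bessel_fusion_sequence scale m W w"
    and A: "A \<in> lin_maps (dsum_scale scale) (dsum m W) scale UNIV"
    and V: "bessel_fusion_sequence scale m V v"
    and AV: "\<And>i. i \<in> {1..m} \<Longrightarrow> V i = A ` (comp_op m W i ` dsum m W)"
  shows "component_preserving m W V (Q_map scale m W A v)"
  unfolding component_preserving_def
proof
  fix j assume j: "j \<in> {1..m}"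
  let ?c = "of_real (1 / v j) :: 'k"
  have c: "?c \<noteq> 0" using bessel_weight_nonzero[OF V j] by simp
  have scaled: "scale ?c ` V j = V j"
    by (rule scale_image_subspace[OF bessel_subspace[OF V j] c])
  have "Q_map scale m W A v (comp_op m W j f) = (\<lambda>i. if i = j then scale ?c (A (comp_op m W j f)) else 0)"
    if "f \<in> dsum m W" for f
    using that j comp_op_in_dsum[OF W that] lin_maps_zero[OF A dsum_zero[OF W]]
    by (auto simp: Q_map_def fun_eq_iff comp_op_comp_op[OF W])
  then have "Q_map scale m W A v ` (comp_op m W j ` dsum m W)
      = (\<lambda>x i. if i = j then x else 0) ` scale ?c ` V j"
    unfolding AV[OF j] image_image by (intro image_cong) auto
  also have "\<dots> = comp_op m V j ` dsum m V"
    unfolding scaled comp_op_image[OF V j] ..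
  finally show "Q_map scale m W A v ` (comp_op m W j ` dsum m W) = comp_op m V j ` dsum m V" .
qed

lemma component_preserving_dual_Q_map:
  assumes W: "fusion_frame scale m W w"
    and V: "bessel_fusion_sequence scale m V v"
    and A: "A \<in> left_inverses scale UNIV (dsum_scale scale) (dsum m W) (analysis scale ip m W w)"
    and AV: "\<And>i. i \<in> {1..m} \<Longrightarrow> V i = A ` (comp_op m W i ` dsum m W)"
  shows "component_preserving_dual scale ip m W w V v (Q_map scale m W A v)"
proof -
  have W': "bessel_fusion_sequence scale m W w" using W by (simp add: fusion_frame_def)
  have Alin: "A \<in> lin_maps (dsum_scale scale) (dsum m W) scale UNIV"
    and Ainv: "A (analysis scale ip m W w x) = x" for x
    using A by (auto simp: left_inverses_def)
  note ana = analysis_in_dsum[OF W']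
  \<comment> \<open>Spanning follows from the left inverse property: splitting the analysis of
    \<open>x\<close> into components and applying \<open>A\<close> writes \<open>x\<close> as a sum
    of elements of the \<open>V i\<close>.\<close>
  have "x \<in> span (\<Union>i\<in>{1..m}. V i)" for x
  proof -
    have "x = (\<Sum>i\<in>{1..m}. A (comp_op m W i (analysis scale ip m W w x)))"
      by (simp only: lin_maps_dsum_eq_sum[OF W' Alin ana, symmetric] Ainv)
    also have "\<dots> \<in> span (\<Union>i\<in>{1..m}. V i)"
    proof (intro span_sum span_base)
      fix i assume i: "i \<in> {1..m}"
      then have "A (comp_op m W i (analysis scale ip m W w x)) \<in> V i" by (simp only: AV imageI ana)
      with i show "A (comp_op m W i (analysis scale ip m W w x)) \<in> (\<Union>i\<in>{1..m}. V i)" by blast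
    qed
    finally show ?thesis .
  qed
  then have "fusion_frame scale m V v" using V by (auto simp: fusion_frame_def)
  then show ?thesis
    using W ana Ainv Q_map_lin_maps[OF W' Alin V AV] synthesis_Q_map[OF W' Alin V AV]
      component_preserving_Q_map[OF W' Alin V AV]
    by (auto simp: component_preserving_dual_def dual_fusion_frame_def fun_eq_iff)
qed

section \<open>From a component preserving dual back to a left inverse\<close>

text \<open>The witness is synthesis after \<open>Q\<close>. It is formed with
  \<open>compose\<close> so that it is \<open>undefined\<close> off the direct sum, as membership in
  \<open>lin_maps\<close> demands.\<close>

lemma component_preserving_dualE:
  assumes dual: "component_preserving_dual scale ip m W w V v Q"
  defines "A \<equiv> compose (dsum m W) (synthesis scale m V v) Q"
  shows "A \<in> left_inverses scale UNIV (dsum_scale scale) (dsum m W) (analysis scale ip m W w)"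
    and "i \<in> {1..m} \<Longrightarrow> V i = A ` (comp_op m W i ` dsum m W)"
    and "Q = Q_map scale m W A v"
proof -
  have W: "bessel_fusion_sequence scale m W w" and V: "bessel_fusion_sequence scale m V v"
    and Q: "Q \<in> lin_maps (dsum_scale scale) (dsum m W) (dsum_scale scale) (dsum m V)"
    and QV: "synthesis scale m V v (Q (analysis scale ip m W w x)) = x"
    and cp: "j \<in> {1..m} \<Longrightarrow> Q ` (comp_op m W j ` dsum m W) = comp_op m V j ` dsum m V" for x j
    using dual by (auto simp: component_preserving_dual_def dual_fusion_frame_def fusion_frame_def
        component_preserving_def fun_eq_iff)
  note ana = analysis_in_dsum[OF W]
  have QX: "f \<in> dsum m W \<Longrightarrow> Q f \<in> dsum m V" for f
    using Q by (auto simp: lin_maps_def)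
  have A: "f \<in> dsum m W \<Longrightarrow> A f = synthesis scale m V v (Q f)" for f
    by (simp add: A_def compose_eq)
  have "A \<in> lin_maps (dsum_scale scale) (dsum m W) scale UNIV"
    using Q QX synthesis_lin_maps[OF V] dsum_add[OF W] dsum_dsum_scale[OF W]
    by (auto simp: lin_maps_def A A_def compose_def)
  then show "A \<in> left_inverses scale UNIV (dsum_scale scale) (dsum m W) (analysis scale ip m W w)"
    using ana QV by (simp add: left_inverses_def A)
  have syn: "synthesis scale m V v (\<lambda>i. if i = j then x else 0) = scale (of_real (v j)) x"
    if "x \<in> V j" "j \<in> {1..m}" for x j
  proof -
    have "synthesis scale m V v (\<lambda>i. if i = j then x else 0)
        = (\<Sum>i\<in>{1..m}. scale (of_real (v i)) (if i = j then x else 0))"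
      using single_in_dsum[OF V that(2,1)] by (simp add: synthesis_def)
    also have "\<dots> = (\<Sum>i\<in>{1..m}. if i = j then scale (of_real (v j)) x else 0)"
      by (intro sum.cong) auto
    finally show ?thesis using that(2) by simp
  qed
  \<comment> \<open>Component preservation only compares images. With linearity it yields that
    \<open>Q\<close> commutes with the component operators: \<open>Q M\<^sub>k f\<close> vanishes
    off \<open>k\<close>, so in the decomposition of \<open>Q f\<close> only the term
    \<open>k = j\<close> contributes to coordinate \<open>j\<close>.\<close>
  have Qcomp: "Q (comp_op m W j f) = (\<lambda>i. if i = j then Q f j else 0)"
    if f: "f \<in> dsum m W" and j: "j \<in> {1..m}" for f j
  proof -
    have supp: "Q (comp_op m W k f) i = 0" if "i \<noteq> k" "k \<in> {1..m}" for i k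
    proof -
      have "Q (comp_op m W k f) \<in> (\<lambda>x i. if i = k then x else 0) ` V k"
        unfolding comp_op_image[OF V that(2), symmetric] cp[OF that(2), symmetric]
        by (intro imageI f)
      then show ?thesis using that(1) by auto
    qed
    have "Q f j = (\<Sum>k\<in>{1..m}. Q (comp_op m W k f) j)"
      by (subst lin_maps_dsum_eq_sum[OF W Q f]) (simp add: sum_fun_apply)
    also have "\<dots> = (\<Sum>k\<in>{1..m}. if j = k then Q (comp_op m W j f) j else 0)"
      using supp by (intro sum.cong) auto
    also have "\<dots> = Q (comp_op m W j f) j" using j by simp
    finally show ?thesis using supp j by auto
  qed
  have Acomp: "A (comp_op m W j f) = scale (of_real (v j)) (Q f j)"
    if f: "f \<in> dsum m W" and j: "j \<in> {1..m}" for f j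
    using A[OF comp_op_in_dsum[OF W f]] Qcomp[OF f j] syn[OF _ j] QX[OF f] j
    by (auto simp: dsum_def)
  show "Q = Q_map scale m W A v"
  proof
    fix f show "Q f = Q_map scale m W A v f"
    proof (cases "f \<in> dsum m W")
      case True
      \<comment> \<open>On \<open>{1..m}\<close> the formula for \<open>A M\<^sub>i f\<close> is
        divided by the nonzero weight \<open>v i\<close>; elsewhere both sides are
        \<open>0\<close>.\<close>
      then have "Q f i = Q_map scale m W A v f i" for i
        using Acomp[OF True, of i] bessel_weight_nonzero[OF V, of i] QX[OF True]
        by (auto simp: Q_map_def dsum_def)
      then show ?thesis by blast
    qed (use Q in \<open>auto simp: Q_map_def lin_maps_def\<close>)
  qed
  assume i: "i \<in> {1..m}"
  let ?s = "scale (of_real (v i) :: 'k)"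
  \<comment> \<open>Here the full image equality is used, not just an inclusion: evaluating both
    sides at \<open>i\<close> undoes the embedding and shows that the \<open>i\<close>-th
    coordinates of \<open>Q f\<close> exhaust \<open>V i\<close>.\<close>
  have "(\<lambda>f. \<lambda>k. if k = i then Q f i else 0) ` dsum m W = (\<lambda>x k. if k = i then x else 0) ` V i"
    using cp[OF i] Qcomp[OF _ i] unfolding comp_op_image[OF V i] image_image by simp
  then have "(\<lambda>g. g i) ` (\<lambda>f. \<lambda>k. if k = i then Q f i else 0) ` dsum m W
      = (\<lambda>g. g i) ` (\<lambda>x k. if k = i then x else 0) ` V i" by simp
  then have Vi: "(\<lambda>f. Q f i) ` dsum m W = V i" by (simp add: image_image)
  have "A ` (comp_op m W i ` dsum m W) = ?s ` V i"
    using Acomp[OF _ i] unfolding Vi[symmetric] image_image by simp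
  also have "\<dots> = V i"
    by (rule scale_image_subspace[OF bessel_subspace[OF V i] bessel_weight_nonzero[OF V i]])
  finally show "V i = A ` (comp_op m W i ` dsum m W)" ..
qed

end

section \<open>Characterization of component preserving duals by left inverses of the analysis
  operator\<close>

theorem theorem3p5:
  fixes scale :: "'k::real_or_complex \<Rightarrow> 'h::ab_group_add \<Rightarrow> 'h"
    and ip :: "'h \<Rightarrow> 'h \<Rightarrow> 'k"
    and m :: nat and W :: "nat \<Rightarrow> 'h set" and w :: "nat \<Rightarrow> real"
  assumes "finite_dim_hilbert scale ip"
    and "fusion_frame scale m W w"
  shows "(\<forall>V v Q. bessel_fusion_sequence scale m V v \<longrightarrow>
            Q \<in> lin_maps (dsum_scale scale) (dsum m W) (dsum_scale scale) (dsum m V) \<longrightarrow>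
            (component_preserving_dual scale ip m W w V v Q \<longleftrightarrow>
              (\<exists>A \<in> left_inverses scale UNIV (dsum_scale scale) (dsum m W) (analysis scale ip m W w).
                (\<forall>i\<in>{1..m}. V i = A ` (comp_op m W i ` dsum m W)) \<and>
                Q = Q_map scale m W A v)))
       \<and> (\<forall>A \<in> left_inverses scale UNIV (dsum_scale scale) (dsum m W) (analysis scale ip m W w).
            \<exists>V v Q. component_preserving_dual scale ip m W w V v Q \<and>
              A = compose (dsum m W) (synthesis scale m V v) Q)"
proof (intro conjI allI impI ballI)
  interpret finite_dim_hilbert scale ip by fact
  fix V v Q
  assume V: "bessel_fusion_sequence scale m V v"
  show "component_preserving_dual scale ip m W w V v Q \<longleftrightarrow>
      (\<exists>A \<in> left_inverses scale UNIV (dsum_scale scale) (dsum m W) (analysis scale ip m W w).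
        (\<forall>i\<in>{1..m}. V i = A ` (comp_op m W i ` dsum m W)) \<and> Q = Q_map scale m W A v)"
  proof
    assume "component_preserving_dual scale ip m W w V v Q"
    note E = component_preserving_dualE[OF this]
    show "\<exists>A \<in> left_inverses scale UNIV (dsum_scale scale) (dsum m W) (analysis scale ip m W w).
        (\<forall>i\<in>{1..m}. V i = A ` (comp_op m W i ` dsum m W)) \<and> Q = Q_map scale m W A v"
      by (intro bexI[OF _ E(1)] conjI ballI E(2,3))
  next
    assume "\<exists>A \<in> left_inverses scale UNIV (dsum_scale scale) (dsum m W) (analysis scale ip m W w).
        (\<forall>i\<in>{1..m}. V i = A ` (comp_op m W i ` dsum m W)) \<and> Q = Q_map scale m W A v"
    then obtain A
      where A: "A \<in> left_inverses scale UNIV (dsum_scale scale) (dsum m W) (analysis scale ip m W w)"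
        and AV: "\<forall>i\<in>{1..m}. V i = A ` (comp_op m W i ` dsum m W)"
        and Q: "Q = Q_map scale m W A v"
      by (elim bexE conjE)
    show "component_preserving_dual scale ip m W w V v Q"
      unfolding Q by (rule component_preserving_dual_Q_map[OF assms(2) V A bspec[OF AV]])
  qed
next
  interpret finite_dim_hilbert scale ip by fact
  fix A
  assume A: "A \<in> left_inverses scale UNIV (dsum_scale scale) (dsum m W) (analysis scale ip m W w)"
  then have Alin: "A \<in> lin_maps (dsum_scale scale) (dsum m W) scale UNIV"
    by (simp add: left_inverses_def)
  have W: "bessel_fusion_sequence scale m W w" using assms(2) by (simp add: fusion_frame_def)
  define V where "V = (\<lambda>i. A ` (comp_op m W i ` dsum m W))"
  \<comment> \<open>Any positive weights would serve, since \<open>Q_map\<close> divides by them and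
    synthesis multiplies them back.\<close>
  define v where "v = (\<lambda>i::nat. 1::real)"
  have V: "bessel_fusion_sequence scale m V v"
    using subspace_image_comp_op[OF W Alin] by (simp add: bessel_fusion_sequence_def V_def v_def)
  \<comment> \<open>Equality of functions must also be checked off the direct sum, where both sides
    are \<open>undefined\<close>.\<close>
  have "A f = compose (dsum m W) (synthesis scale m V v) (Q_map scale m W A v) f" for f
  proof (cases "f \<in> dsum m W")
    case True
    then show ?thesis
      using synthesis_Q_map[OF W Alin V _ True] by (simp add: compose_eq V_def)
  next
    case False
    then show ?thesis
      using Alin by (auto simp: compose_def lin_maps_def)
  qed
  then have "A = compose (dsum m W) (synthesis scale m V v) (Q_map scale m W A v)" ..
  moreover have "component_preserving_dual scale ip m W w V v (Q_map scale m W A v)"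
    by (rule component_preserving_dual_Q_map[OF assms(2) V A]) (simp add: V_def)
  ultimately show "\<exists>V v Q. component_preserving_dual scale ip m W w V v Q \<and>
      A = compose (dsum m W) (synthesis scale m V v) Q"
    by (intro exI conjI)
qed

end
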